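(* Let $\mu$ be a probability measure on $\mathbb N^d$ with downward closed support and finite mean vector $\mathbf m\in\mathbb R_{>0}^d$, and let $\mathbf X\sim\mu$. Suppose that $\mu\in\mathrm{WLSI}(1)$. For $\mathbf t\in\mathbb R^d$ satisfying $t_i>-m_i$ for every $i\in\{1,\dots,d\}$, define the orthant event $$\mathcal O_{\mathbf t}=\bigcap_{i:\,t_i>0}\{X_i-m_i\ge t_i\}\;\cap\;\bigcap_{i:\,t_i<0}\{X_i-m_i\le t_i\}.$$ Then $$\Pr_\mu[\mathcal O_{\mathbf t}]\;\le\;\exp\Big(-\sum_{i=1}^d\frac{t_i^2}{2m_i}\,h\Big(\frac{t_i}{m_i}\Big)\Big),$$ where $h(x)=2\,\dfrac{(1+x)\log(1+x)-x}{x^2}$ for $x\ge-1$, with $h(0)=1$ and the convention $0\log0=0$.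
   Context: $\mathbb N=\{0,1,2,\dots\}$; $\mathbf e_i$ is the $i$-th standard basis vector. A set $S\subseteq\mathbb N^d$ is downward closed if $\mathbf n\in S$ and $\mathbf 0\le\mathbf m\le\mathbf n$ (coordinatewise) imply $\mathbf m\in S$. For $\mathbf n\in\mathrm{supp}(\mu)$ let $b_i(\mathbf n)=(n_i+1)\mu(\mathbf n+\mathbf e_i)/\mu(\mathbf n)$, and for $f:\mathrm{supp}(\mu)\to\mathbb R$ let $\nabla_i^+f(\mathbf n)=f(\mathbf n+\mathbf e_i)-f(\mathbf n)$; terms with $\mathbf n+\mathbf e_i\notin\mathrm{supp}(\mu)$ have $b_i(\mathbf n)=0$ and are interpreted as $0$. Let $\mathcal E(f,f)=\mathbf E_\mu\big[\sum_{i=1}^d b_i(\nabla_i^+f)^2\big]$, $\mathcal D(\mathcal E)=\{f\in L^2(\mu):\mathcal E(f,f)<\infty\}$, $\mathcal A=\{f\in L^2(\mu):f>0,\ f\in\mathcal D(\mathcal E),\ \log f\in\mathcal D(\mathcal E)\}$, $\Psi(u,v)=(u+v)\log(u+v)-u\log u-v(\log u+1)$ with $\Psi(0,0)=0$, and $\mathrm{Ent}_\mu[f]=\mathbf E_\mu[f\log f]-\mathbf E_\mu[f]\log\mathbf E_\mu[f]$. We write $\mu\in\mathrm{WLSI}(1)$ if $$\mathrm{Ent}_\mu[f]\le\mathbf E_\mu\Big[\sum_{i=1}^d b_i\,\Psi(f,\nabla_i^+f)\Big]\qquad\text{for all } f\in\mathcal A .$$ *)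

theory Defs
  imports "HOL-Probability.Probability"
begin

text \<open>
  Points of $\mathbb{N}^d$ are vectors of type \<open>nat ^ 'd\<close> with \<open>'d\<close> a finite index type, and probability
  measures on this countable discrete space are PMFs; the support of \<open>\<mu>\<close> is \<open>set_pmf \<mu>\<close>.
  Functions on the support are total functions; no definition below depends on their
  values outside the support.
\<close>

definition downward_closed :: "(nat ^ 'd::finite) set \<Rightarrow> bool" where
  "downward_closed S \<longleftrightarrow> (\<forall>n\<in>S. \<forall>m. (\<forall>i. m $ i \<le> n $ i) \<longrightarrow> m \<in> S)"

definition birth_rate :: "(nat ^ 'd::finite) pmf \<Rightarrow> 'd \<Rightarrow> nat ^ 'd \<Rightarrow> real" where
  "birth_rate \<mu> i n = (real (n $ i) + 1) * pmf \<mu> (n + axis i 1) / pmf \<mu> n"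

text \<open>
  If \<open>n + axis i 1\<close> is outside the support, then \<open>fwd_diff i f n\<close> is a meaningless number, but it is
  only ever used in products with \<open>birth_rate \<mu> i n = 0\<close>.
\<close>
definition fwd_diff :: "'d::finite \<Rightarrow> (nat ^ 'd \<Rightarrow> real) \<Rightarrow> nat ^ 'd \<Rightarrow> real" where
  "fwd_diff i f n = f (n + axis i 1) - f n"

definition dirichlet_energy :: "(nat ^ 'd::finite) pmf \<Rightarrow> (nat ^ 'd \<Rightarrow> real) \<Rightarrow> ennreal" where
  "dirichlet_energy \<mu> f =
     (\<integral>\<^sup>+ n. ennreal (\<Sum>i\<in>UNIV. birth_rate \<mu> i n * (fwd_diff i f n)\<^sup>2) \<partial>measure_pmf \<mu>)"

definition L2_pmf :: "'a pmf \<Rightarrow> ('a \<Rightarrow> real) set" where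
  "L2_pmf \<mu> = {f. integrable (measure_pmf \<mu>) (\<lambda>n. (f n)\<^sup>2)}"

definition dirichlet_domain :: "(nat ^ 'd::finite) pmf \<Rightarrow> (nat ^ 'd \<Rightarrow> real) set" where
  "dirichlet_domain \<mu> = {f \<in> L2_pmf \<mu>. dirichlet_energy \<mu> f < \<infinity>}"

definition admissible :: "(nat ^ 'd::finite) pmf \<Rightarrow> (nat ^ 'd \<Rightarrow> real) set" where
  "admissible \<mu> = {f \<in> L2_pmf \<mu>. (\<forall>n\<in>set_pmf \<mu>. f n > 0) \<and>
     f \<in> dirichlet_domain \<mu> \<and> (\<lambda>n. ln (f n)) \<in> dirichlet_domain \<mu>}"

text \<open>The conventions $\Psi(0,0) = 0$ and $0 \log 0 = 0$ hold automatically, since \<open>0 * ln 0 = 0\<close>.\<close>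
definition Psi :: "real \<Rightarrow> real \<Rightarrow> real" where
  "Psi u v = (u + v) * ln (u + v) - u * ln u - v * (ln u + 1)"

definition Ent :: "'a pmf \<Rightarrow> ('a \<Rightarrow> real) \<Rightarrow> real" where
  "Ent \<mu> f = measure_pmf.expectation \<mu> (\<lambda>n. f n * ln (f n))
     - measure_pmf.expectation \<mu> f * ln (measure_pmf.expectation \<mu> f)"

text \<open>
  For admissible \<open>f\<close> the entropy is a nonnegative real (\<open>f\<close> and $f \log f$ are integrable because \<open>f\<close> is
  positive and square integrable), and the integrand on the right is nonnegative on the support, as
  $\Psi(u, v)$ is the Bregman divergence of $x \log x$ between $u + v$ and $u$.  So the inequality
  can be stated in \<open>ennreal\<close>, where the right-hand side needs no integrability side condition.
\<close>
definition WLSI1 :: "(nat ^ 'd::finite) pmf \<Rightarrow> bool" where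
  "WLSI1 \<mu> \<longleftrightarrow> (\<forall>f\<in>admissible \<mu>. ennreal (Ent \<mu> f) \<le>
     (\<integral>\<^sup>+ n. ennreal (\<Sum>i\<in>UNIV. birth_rate \<mu> i n * Psi (f n) (fwd_diff i f n)) \<partial>measure_pmf \<mu>))"

definition orthant_event :: "real ^ 'd::finite \<Rightarrow> real ^ 'd \<Rightarrow> (nat ^ 'd) set" where
  "orthant_event m t =
     (\<Inter>i\<in>{i. t $ i > 0}. {n. real (n $ i) - m $ i \<ge> t $ i}) \<inter>
     (\<Inter>i\<in>{i. t $ i < 0}. {n. real (n $ i) - m $ i \<le> t $ i})"

definition h :: "real \<Rightarrow> real" where
  "h x = (if x = 0 then 1 else 2 * ((1 + x) * ln (1 + x) - x) / x\<^sup>2)"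

end

theory Submission
  imports Defs
begin

text \<open>
  A Herbst argument. For $v_i > -1$ apply the inequality to $f = \prod_i (1 + v_i)^{Y_i}$ with
  $Y_i = \min(X_i, K)$; the truncation makes $f$ and $\log f$ bounded, hence $f$ admissible. Summation
  by parts turns $\mathbf{E}[b_i\, g(\cdot + \mathbf{e}_i)]$ into $\mathbf{E}[X_i\, g]$, and with
  $F(v) = \mathbf{E} f$ the inequality becomes $\sum_i v_i\, \partial_{v_i} F \le F \log F$. Along the
  ray $v = r u$ this says that $\log F(r u) / r$ is nonincreasing in $r$, so $\log F(u)$ is at most its
  limit $\sum_i u_i \mathbf{E} Y_i$ at $r = 0$. Markov's inequality with $u_i = t_i / m_i$ and
  $K \to \infty$ give the Poisson-type tail.
\<close>

section \<open>Truncation to a finite box and product weights\<close>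

definition trunc :: "nat \<Rightarrow> nat ^ 'd::finite \<Rightarrow> nat ^ 'd" where
  "trunc K n = (\<chi> i. min (n $ i) K)"

text \<open>The exponential weight of a linear function, parametrized by \<open>1 + v $ i\<close>
  instead of its logarithm. Its expectation is the factorial moment generating function at
  \<open>v\<close>, and for fixed \<open>n\<close> it is a polynomial in \<open>v\<close>.\<close>

definition tilt :: "real ^ 'd::finite \<Rightarrow> nat ^ 'd \<Rightarrow> real" where
  "tilt v n = (\<Prod>i\<in>UNIV. (1 + v $ i) ^ (n $ i))"

lemma trunc_nth [simp]: "trunc K n $ i = min (n $ i) K"
  by (simp add: trunc_def)

lemma finite_range_trunc: "finite (range (trunc K :: nat ^ 'd::finite \<Rightarrow> _))"
proof -
  have "trunc K n \<in> vec_lambda ` (UNIV \<rightarrow>\<^sub>E {..K})" for n :: "nat ^ 'd"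
    by (rule image_eqI[of _ _ "vec_nth (trunc K n)"]) (auto simp: vec_nth_inverse)
  then have "range (trunc K :: nat ^ 'd \<Rightarrow> _) \<subseteq> vec_lambda ` (UNIV \<rightarrow>\<^sub>E {..K})"
    by auto
  then show ?thesis
    by (rule finite_subset) (intro finite_imageI finite_PiE; simp)
qed

lemma bounded_range_trunc: "bounded (range (\<lambda>n. g (trunc K n)))"
  for g :: "nat ^ 'd::finite \<Rightarrow> real"
proof -
  have "range (\<lambda>n. g (trunc K n)) = g ` range (trunc K)"
    by auto
  then show ?thesis
    using finite_range_trunc by (metis finite_imageI finite_imp_bounded)
qed

lemma integrable_trunc [simp, intro]: "integrable (measure_pmf \<mu>) (\<lambda>n. g (trunc K n))"
  for g :: "nat ^ 'd::finite \<Rightarrow> real"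
proof -
  obtain B where "\<And>n. \<bar>g (trunc K n)\<bar> \<le> B"
    using bounded_range_trunc[of g K] by (auto simp: bounded_iff)
  then show ?thesis
    by (intro measure_pmf.integrable_const_bound[where B = B]) auto
qed

text \<open>A finite sum over the box, so that an expectation depending on a parameter can be
  differentiated term by term.\<close>

lemma expectation_trunc:
  fixes g :: "nat ^ 'd::finite \<Rightarrow> real"
  shows "measure_pmf.expectation \<mu> (\<lambda>n. g (trunc K n)) =
    (\<Sum>y\<in>range (trunc K). pmf (map_pmf (trunc K) \<mu>) y * g y)"
proof -
  have "measure_pmf.expectation \<mu> (\<lambda>n. g (trunc K n))
      = measure_pmf.expectation (map_pmf (trunc K) \<mu>) g"
    by simp
  also have "\<dots> = (\<Sum>y\<in>range (trunc K). g y * pmf (map_pmf (trunc K) \<mu>) y)"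
    by (rule integral_measure_pmf_real) (auto simp: finite_range_trunc)
  finally show ?thesis
    by (simp add: mult.commute)
qed

section \<open>Summation by parts and finite energy of bounded functions\<close>

lemma birth_rate_nonneg: "birth_rate \<mu> i n \<ge> 0"
  by (simp add: birth_rate_def)

text \<open>Reindexing by \<open>n + axis i 1\<close>: on the support the weight
  \<open>pmf \<mu> n * birth_rate \<mu> i n\<close> is the mass of the shifted point times its
  coordinate \<open>i\<close>. In general this gives only an inequality, because the shifted point
  may carry mass when \<open>n\<close> has none.\<close>

lemma nn_integral_birth_rate_le:
  fixes \<mu> :: "(nat ^ 'd::finite) pmf"
  assumes "\<And>n. g n \<ge> 0"
  shows "(\<integral>\<^sup>+ n. ennreal (birth_rate \<mu> i n * g (n + axis i 1)) \<partial>measure_pmf \<mu>)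
    \<le> (\<integral>\<^sup>+ n. ennreal (real (n $ i) * g n) \<partial>measure_pmf \<mu>)"
proof -
  let ?H = "\<lambda>n. ennreal (pmf \<mu> n * (real (n $ i) * g n))"
  let ?s = "\<lambda>n::nat ^ 'd. n + axis i 1"
  have "(\<integral>\<^sup>+ n. ennreal (birth_rate \<mu> i n * g (?s n)) \<partial>measure_pmf \<mu>)
      = (\<integral>\<^sup>+ n. ennreal (pmf \<mu> n * (birth_rate \<mu> i n * g (?s n))) \<partial>count_space UNIV)"
    using assms by (simp add: nn_integral_measure_pmf ennreal_mult birth_rate_nonneg)
  also have "\<dots> \<le> (\<integral>\<^sup>+ n. ?H (?s n) \<partial>count_space UNIV)"
  proof (intro nn_integral_mono ennreal_leI)
    fix n
    show "pmf \<mu> n * (birth_rate \<mu> i n * g (?s n)) \<le> pmf \<mu> (?s n) * (real (?s n $ i) * g (?s n))"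
      using assms by (cases "pmf \<mu> n = 0") (auto simp: birth_rate_def mult_ac simp del: One_nat_def)
  qed
  also have "\<dots> = (\<integral>\<^sup>+ n. ?H n \<partial>count_space (range ?s))"
    by (intro nn_integral_bij_count_space) (simp add: bij_betw_def inj_on_def)
  also have "\<dots> \<le> (\<integral>\<^sup>+ n. ?H n \<partial>count_space UNIV)"
    by (subst nn_integral_count_space_indicator)
       (auto intro!: nn_integral_mono simp: indicator_def)
  also have "\<dots> = (\<integral>\<^sup>+ n. ennreal (real (n $ i) * g n) \<partial>measure_pmf \<mu>)"
    using assms by (simp add: nn_integral_measure_pmf ennreal_mult)
  finally show ?thesis .
qed

text \<open>If \<bar>f\<bar> \<le> B, increments are at most 2B in modulus, so the energy is at most
  (2B)^2 times the sum of the expected birth rates. Summation by parts with a constant function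
  bounds each of these by a mean.\<close>

lemma bounded_in_dirichlet_domain:
  fixes \<mu> :: "(nat ^ 'd::finite) pmf"
  assumes mean: "\<And>i. integrable (measure_pmf \<mu>) (\<lambda>n. real (n $ i))"
    and bdd: "bounded (range f)"
  shows "f \<in> dirichlet_domain \<mu>"
proof -
  obtain B where B: "\<And>n. \<bar>f n\<bar> \<le> B"
    using bdd by (auto simp: bounded_iff)
  have "\<bar>(f n)\<^sup>2\<bar> \<le> B\<^sup>2" for n
    using power_mono[OF B[of n], of 2] by simp
  then have L2: "f \<in> L2_pmf \<mu>"
    unfolding L2_pmf_def by (auto intro!: measure_pmf.integrable_const_bound[where B = "B\<^sup>2"])
  have "(fwd_diff i f n)\<^sup>2 \<le> (2 * B)\<^sup>2" for i n
    using B[of n] B[of "n + axis i 1"] by (intro power2_le_iff_abs_le[THEN iffD2]) (auto simp: fwd_diff_def)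
  then have "dirichlet_energy \<mu> f
      \<le> (\<integral>\<^sup>+ n. (\<Sum>i\<in>UNIV. ennreal (birth_rate \<mu> i n * (2 * B)\<^sup>2)) \<partial>measure_pmf \<mu>)"
    unfolding dirichlet_energy_def
    by (subst sum_ennreal)
       (auto intro!: nn_integral_mono ennreal_leI sum_mono mult_left_mono simp: birth_rate_nonneg)
  also have "\<dots> = (\<Sum>i\<in>UNIV. \<integral>\<^sup>+ n. ennreal (birth_rate \<mu> i n * (2 * B)\<^sup>2) \<partial>measure_pmf \<mu>)"
    by (rule nn_integral_sum) simp
  also have "\<dots> < \<infinity>"
  proof -
    have "(\<integral>\<^sup>+ n. ennreal (birth_rate \<mu> i n * (2 * B)\<^sup>2) \<partial>measure_pmf \<mu>) < \<infinity>" for i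
    proof -
      have "(\<integral>\<^sup>+ n. ennreal (birth_rate \<mu> i n * (2 * B)\<^sup>2) \<partial>measure_pmf \<mu>)
          \<le> (\<integral>\<^sup>+ n. ennreal (real (n $ i) * (2 * B)\<^sup>2) \<partial>measure_pmf \<mu>)"
        by (rule nn_integral_birth_rate_le) simp
      also have "\<dots> = ennreal (measure_pmf.expectation \<mu> (\<lambda>n. real (n $ i) * (2 * B)\<^sup>2))"
        using mean[of i] by (intro nn_integral_eq_integral integrable_mult_left) auto
      finally show ?thesis
        by (simp add: order_le_less_trans)
    qed
    then show ?thesis
      by (simp add: less_top)
  qed
  finally show ?thesis
    using L2 by (simp add: dirichlet_domain_def)
qed

section \<open>The log-Sobolev inequality for truncated tilts\<close>

lemma tilt_pos: "(\<And>i. v $ i > - 1) \<Longrightarrow> tilt v n > 0"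
  unfolding tilt_def
  by (intro prod_pos ballI zero_less_power) (metis add.right_inverse add_less_cancel_left)

lemma ln_tilt:
  assumes "\<And>i. v $ i > - 1"
  shows "ln (tilt v n) = (\<Sum>i\<in>UNIV. real (n $ i) * ln (1 + v $ i))"
proof -
  have *: "1 + v $ i > 0" for i
    using assms[of i] by linarith
  show ?thesis
    unfolding tilt_def by (subst ln_prod) (auto simp: * ln_realpow less_imp_neq[OF *, symmetric])
qed

lemma tilt_trunc_add_axis:
  "tilt v (trunc K (n + axis i 1)) =
    (if n $ i < K then 1 + v $ i else 1) * tilt v (trunc K n)"
proof -
  have "(\<Prod>j\<in>UNIV - {i}. (1 + v $ j) ^ (trunc K (n + axis i 1) $ j))
      = (\<Prod>j\<in>UNIV - {i}. (1 + v $ j) ^ (trunc K n $ j))"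
    by (intro prod.cong) (auto simp: axis_def)
  moreover have "(1 + v $ i) ^ (trunc K (n + axis i 1) $ i)
      = (if n $ i < K then 1 + v $ i else 1) * (1 + v $ i) ^ (trunc K n $ i)"
    by (auto simp: axis_def min_def)
  ultimately show ?thesis
    unfolding tilt_def
    by (subst (1 2) prod.remove[where x = i]) (simp_all only: finite UNIV_I mult.assoc)
qed

text \<open>\<open>Psi\<close> is homogeneous of degree one, and the factor on the right is
  \<open>Psi 1 x\<close>. An increment of a tilt is a multiple of the tilt itself, so its
  \<open>Psi\<close> term is again a multiple of the tilt.\<close>

lemma Psi_scale:
  assumes "c > 0" "x > -1"
  shows "Psi c (x * c) = ((1 + x) * ln (1 + x) - x) * c"
proof -
  have "c + x * c = (1 + x) * c"
    by (simp add: algebra_simps)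
  moreover have "ln ((1 + x) * c) = ln (1 + x) + ln c"
    using assms by (intro ln_mult_pos) auto
  ultimately show ?thesis
    by (simp add: Psi_def algebra_simps)
qed

text \<open>The bound ln y \<le> y - 1 at y = 1 / (1 + x). It makes the \<open>Psi\<close> terms
  nonnegative, as \<open>nn_integral_birth_rate_le\<close> demands.\<close>

lemma entropy_function_nonneg: "(1 + x) * ln (1 + x) - x \<ge> 0" if "x > -1" for x :: real
proof -
  have "ln (1 / (1 + x)) \<le> 1 / (1 + x) - 1"
    using that by (intro ln_le_minus_one) simp
  then have "(1 + x) * - ln (1 + x) \<le> (1 + x) * (1 / (1 + x) - 1)"
    using that by (intro mult_left_mono) (auto simp: ln_div)
  also have "\<dots> = - x"
    using that by (simp add: field_simps)
  finally show ?thesis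
    by simp
qed

text \<open>With \<open>M i\<close> the expectation of the truncated coordinate times
  \<open>f\<close>, the entropy side has coefficients ln (1 + v_i) and the energy side ln (1 + v_i)
  - v_i / (1 + v_i). The logarithms cancel. Since \<open>M i\<close> / (1 + v_i) is the partial
  derivative of the expected tilt in v_i, the left side is the Euler operator applied to that
  expectation.\<close>

lemma WLSI1_tilt:
  fixes \<mu> :: "(nat ^ 'd::finite) pmf" and K :: nat
  assumes mean: "\<And>i. integrable (measure_pmf \<mu>) (\<lambda>n. real (n $ i))"
    and wlsi: "WLSI1 \<mu>"
    and v: "\<And>i. v $ i > - 1"
  defines "f \<equiv> \<lambda>n. tilt v (trunc K n)"
  shows "(\<Sum>i\<in>UNIV. v $ i / (1 + v $ i) *
      measure_pmf.expectation \<mu> (\<lambda>n. real (trunc K n $ i) * f n))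
    \<le> measure_pmf.expectation \<mu> f * ln (measure_pmf.expectation \<mu> f)"
proof -
  let ?E = "measure_pmf.expectation \<mu>"
  define M where "M = (\<lambda>i. ?E (\<lambda>n. real (trunc K n $ i) * f n))"
  define c where "c = (\<lambda>i. (1 + v $ i) * ln (1 + v $ i) - v $ i)"
  have v': "1 + v $ i > 0" for i
    using v[of i] by linarith
  have c: "c i \<ge> 0" for i
    unfolding c_def by (rule entropy_function_nonneg[OF v])
  have fpos: "f n > 0" for n
    unfolding f_def by (rule tilt_pos[OF v])
  have intM: "integrable (measure_pmf \<mu>) (\<lambda>n. real (trunc K n $ i) * f n)" for i
    unfolding f_def by (rule integrable_trunc[of _ "\<lambda>y. real (y $ i) * tilt v y"])
  have "f \<in> dirichlet_domain \<mu>" "(\<lambda>n. ln (f n)) \<in> dirichlet_domain \<mu>"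
    using bounded_range_trunc[of "tilt v" K] bounded_range_trunc[of "\<lambda>y. ln (tilt v y)" K]
    by (auto intro!: bounded_in_dirichlet_domain mean simp: f_def)
  then have adm: "f \<in> admissible \<mu>"
    using fpos by (auto simp: admissible_def dirichlet_domain_def)
  have "?E (\<lambda>n. f n * ln (f n))
      = ?E (\<lambda>n. \<Sum>i\<in>UNIV. ln (1 + v $ i) * (real (trunc K n $ i) * f n))"
    unfolding f_def by (simp add: ln_tilt[OF v] sum_distrib_left mult_ac)
  also have "\<dots> = (\<Sum>i\<in>UNIV. ln (1 + v $ i) * M i)"
    unfolding M_def using intM by (subst Bochner_Integration.integral_sum) auto
  finally have Ent: "Ent \<mu> f = (\<Sum>i\<in>UNIV. ln (1 + v $ i) * M i) - ?E f * ln (?E f)"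
    by (simp add: Ent_def)
  \<comment> \<open>Summation by parts needs the \<open>Psi\<close> term at \<open>n\<close> as a
    function of the shifted point. The condition n_i < K becomes coordinate at most K there, and
    \<open>f n\<close> is the shifted value divided by 1 + v_i. Beyond K the increment
    vanishes.\<close>
  define g where "g = (\<lambda>i n. (if n $ i \<le> K then c i / (1 + v $ i) * f n else 0))"
  have g: "g i n \<ge> 0" for i n
    using c[of i] v'[of i] fpos[of n] by (simp add: g_def)
  have Psi_eq: "Psi (f n) (fwd_diff i f n) = g i (n + axis i 1)" for i n
  proof (cases "n $ i < K")
    case True
    then have "f (n + axis i 1) = (1 + v $ i) * f n"
      by (simp add: f_def tilt_trunc_add_axis del: One_nat_def)
    moreover from this have "fwd_diff i f n = v $ i * f n"
      by (simp add: fwd_diff_def algebra_simps)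
    ultimately show ?thesis
      using True v'[of i] by (simp add: Psi_scale[OF fpos v] g_def c_def axis_def)
  next
    case False
    then have "f (n + axis i 1) = f n"
      by (simp add: f_def tilt_trunc_add_axis del: One_nat_def)
    then show ?thesis
      using False by (simp add: fwd_diff_def Psi_def g_def)
  qed
  have "ennreal (Ent \<mu> f)
      \<le> (\<integral>\<^sup>+ n. ennreal (\<Sum>i\<in>UNIV. birth_rate \<mu> i n * Psi (f n) (fwd_diff i f n)) \<partial>measure_pmf \<mu>)"
    using wlsi adm by (auto simp: WLSI1_def)
  also have "\<dots> = (\<integral>\<^sup>+ n. (\<Sum>i\<in>UNIV. ennreal (birth_rate \<mu> i n * g i (n + axis i 1))) \<partial>measure_pmf \<mu>)"
    by (simp add: Psi_eq sum_ennreal g birth_rate_nonneg)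
  also have "\<dots> = (\<Sum>i\<in>UNIV. \<integral>\<^sup>+ n. ennreal (birth_rate \<mu> i n * g i (n + axis i 1)) \<partial>measure_pmf \<mu>)"
    by (rule nn_integral_sum) simp
  also have "\<dots> \<le> (\<Sum>i\<in>UNIV. ennreal (c i / (1 + v $ i) * M i))"
  proof (rule sum_mono)
    fix i
    have "(\<integral>\<^sup>+ n. ennreal (birth_rate \<mu> i n * g i (n + axis i 1)) \<partial>measure_pmf \<mu>)
        \<le> (\<integral>\<^sup>+ n. ennreal (real (n $ i) * g i n) \<partial>measure_pmf \<mu>)"
      by (rule nn_integral_birth_rate_le) (rule g)
    \<comment> \<open>Where \<open>g i\<close> is nonzero the coordinate is at most K and equals its
      truncation; elsewhere the right integrand is nonnegative.\<close>
    also have "\<dots> \<le> (\<integral>\<^sup>+ n. ennreal (c i / (1 + v $ i) * (real (trunc K n $ i) * f n)) \<partial>measure_pmf \<mu>)"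
      using c[of i] v'[of i] fpos
      by (intro nn_integral_mono ennreal_leI) (auto simp: g_def min_def less_imp_le mult_ac)
    also have "\<dots> = ennreal (?E (\<lambda>n. c i / (1 + v $ i) * (real (trunc K n $ i) * f n)))"
      using c[of i] v'[of i] fpos intM[of i]
      by (intro nn_integral_eq_integral) (auto simp: less_imp_le simp del: trunc_nth)
    finally show "(\<integral>\<^sup>+ n. ennreal (birth_rate \<mu> i n * g i (n + axis i 1)) \<partial>measure_pmf \<mu>)
        \<le> ennreal (c i / (1 + v $ i) * M i)"
      by (simp add: M_def)
  qed
  finally have "ennreal (Ent \<mu> f) \<le> (\<Sum>i\<in>UNIV. ennreal (c i / (1 + v $ i) * M i))" .
  moreover have nonneg: "c i / (1 + v $ i) * M i \<ge> 0" for i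
    using c[of i] v'[of i] fpos
    by (auto simp: M_def less_imp_le intro!: mult_nonneg_nonneg Bochner_Integration.integral_nonneg)
  ultimately have "Ent \<mu> f \<le> (\<Sum>i\<in>UNIV. c i / (1 + v $ i) * M i)"
    by (simp add: sum_ennreal ennreal_le_iff sum_nonneg)
  also have "\<dots> = (\<Sum>i\<in>UNIV. ln (1 + v $ i) * M i) - (\<Sum>i\<in>UNIV. v $ i / (1 + v $ i) * M i)"
    unfolding sum_subtractf[symmetric] using v'
    by (intro sum.cong) (auto simp: c_def diff_divide_distrib left_diff_distrib less_imp_neq[symmetric])
  finally show ?thesis
    unfolding Ent M_def by linarith
qed

section \<open>Integration of the differential inequality along rays\<close>

lemma le_deriv_at_0_if_euler_le:
  fixes \<phi> :: "real \<Rightarrow> real"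
  assumes deriv: "\<And>r. 0 \<le> r \<Longrightarrow> r \<le> 1 \<Longrightarrow> (\<phi> has_real_derivative \<phi>' r) (at r)"
    and "\<phi> 0 = 0"
    and euler: "\<And>r. 0 < r \<Longrightarrow> r \<le> 1 \<Longrightarrow> r * \<phi>' r \<le> \<phi> r"
  shows "\<phi> 1 \<le> \<phi>' 0"
proof -
  \<comment> \<open>The quotient rule gives \<phi>(r)/r a derivative with numerator r \<phi>'(r) -
    \<phi>(r), which \<open>euler\<close> makes nonpositive.\<close>
  have ratio: "\<phi> 1 \<le> \<phi> r / r" if "0 < r" "r \<le> 1" for r
  proof -
    have "\<phi> 1 / 1 \<le> \<phi> r / r"
    proof (rule DERIV_nonpos_imp_nonincreasing[OF \<open>r \<le> 1\<close>])
      fix x assume x: "r \<le> x" "x \<le> 1"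
      have "((\<lambda>x. \<phi> x / x) has_real_derivative (\<phi>' x * x - \<phi> x * 1) / (x * x)) (at x)"
        using that x by (intro DERIV_divide deriv DERIV_ident) auto
      moreover have "(\<phi>' x * x - \<phi> x * 1) / (x * x) \<le> 0"
        using euler[of x] that x by (simp add: divide_le_0_iff mult.commute)
      ultimately show "\<exists>y. ((\<lambda>x. \<phi> x / x) has_real_derivative y) (at x) \<and> y \<le> 0"
        by blast
    qed
    then show ?thesis
      by simp
  qed
  \<comment> \<open>As \<phi>(0) = 0, this ratio is the difference quotient at 0.\<close>
  have "((\<lambda>r. \<phi> r / r) \<longlongrightarrow> \<phi>' 0) (at_right 0)"
    using deriv[of 0] \<open>\<phi> 0 = 0\<close>
    by (auto simp: has_field_derivative_iff intro: tendsto_mono[OF at_le])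
  moreover have "eventually (\<lambda>r. \<phi> 1 \<le> \<phi> r / r) (at_right 0)"
    using ratio by (auto simp: eventually_at_right_field intro!: exI[of _ 1])
  ultimately show ?thesis
    by (rule tendsto_lowerbound) simp
qed

text \<open>The product rule, with each lowered power written as a division by
  \<open>1 + r * u $ i\<close> to match the terms in \<open>WLSI1_tilt\<close>.\<close>

lemma tilt_has_derivative:
  assumes "\<And>i. 1 + r * u $ i > 0"
  shows "((\<lambda>r. tilt (r *\<^sub>R u) y) has_real_derivative
    (\<Sum>i\<in>UNIV. u $ i / (1 + r * u $ i) * (real (y $ i) * tilt (r *\<^sub>R u) y))) (at r)"
proof -
  have "((\<lambda>r. \<Prod>i\<in>UNIV. (1 + r * u $ i) ^ (y $ i)) has_real_derivative
      (\<Sum>i\<in>UNIV. (real (y $ i) * (u $ i * (1 + r * u $ i) ^ (y $ i - 1)))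
        * (\<Prod>j\<in>UNIV - {i}. (1 + r * u $ j) ^ (y $ j)))) (at r)"
    by (rule has_field_derivative_prod) (auto intro!: derivative_eq_intros)
  moreover have "(real (y $ i) * (u $ i * (1 + r * u $ i) ^ (y $ i - 1)))
        * (\<Prod>j\<in>UNIV - {i}. (1 + r * u $ j) ^ (y $ j))
      = u $ i / (1 + r * u $ i) * (real (y $ i) * tilt (r *\<^sub>R u) y)" for i
  \<comment> \<open>The exponent \<open>y $ i - 1\<close> is a truncated subtraction; when
    \<open>y $ i\<close> is 0 the factor \<open>real (y $ i)\<close> annihilates both sides.\<close>
  proof (cases "y $ i")
    case (Suc k)
    have "tilt (r *\<^sub>R u) y
        = (1 + r * u $ i) * (1 + r * u $ i) ^ k * (\<Prod>j\<in>UNIV - {i}. (1 + r * u $ j) ^ (y $ j))"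
      unfolding tilt_def using Suc by (subst prod.remove[where x = i]) auto
    then show ?thesis
      using assms[of i] Suc by (simp add: field_simps)
  qed simp
  ultimately show ?thesis
    by (simp add: tilt_def)
qed

text \<open>\<open>le_deriv_at_0_if_euler_le\<close> applied to the logarithm of the expected tilt
  along the ray through \<open>u\<close>. Without truncation, independent Poisson coordinates give
  equality.\<close>

lemma expectation_tilt_le:
  fixes \<mu> :: "(nat ^ 'd::finite) pmf"
  assumes mean: "\<And>i. integrable (measure_pmf \<mu>) (\<lambda>n. real (n $ i))"
    and wlsi: "WLSI1 \<mu>"
    and u: "\<And>i. u $ i > - 1"
  shows "measure_pmf.expectation \<mu> (\<lambda>n. tilt u (trunc K n))
    \<le> exp (\<Sum>i\<in>UNIV. u $ i * measure_pmf.expectation \<mu> (\<lambda>n. real (trunc K n $ i)))"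
proof -
  let ?E = "measure_pmf.expectation \<mu>"
  define F where "F = (\<lambda>r. ?E (\<lambda>n. tilt (r *\<^sub>R u) (trunc K n)))"
  define M where "M = (\<lambda>r i. ?E (\<lambda>n. real (trunc K n $ i) * tilt (r *\<^sub>R u) (trunc K n)))"
  define F' where "F' = (\<lambda>r. \<Sum>i\<in>UNIV. u $ i / (1 + r * u $ i) * M r i)"
  have ru: "r * u $ i > - 1" if "0 \<le> r" "r \<le> 1" for r i
  proof (cases "u $ i \<ge> 0")
    case True
    then show ?thesis
      using that by (simp add: less_le_trans[of _ 0])
  next
    case False
    then have "u $ i * 1 \<le> u $ i * r"
      using that by (intro mult_left_mono_neg) auto
    then show ?thesis
      using u[of i] by (simp add: mult.commute)
  qed
  have Fpos: "F r > 0" if "0 \<le> r" "r \<le> 1" for r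
  proof -
    have "tilt (r *\<^sub>R u) n > 0" for n
      using ru[OF that] by (intro tilt_pos) simp
    then show ?thesis
      unfolding F_def
      by (intro measure_pmf.expectation_greater) auto
  qed
  have derivF: "(F has_real_derivative F' r) (at r)" if "0 \<le> r" "r \<le> 1" for r
  proof -
    have pos: "1 + r * u $ i > 0" for i
      using ru[OF that, of i] by linarith
    let ?D = "\<lambda>y. \<Sum>i\<in>UNIV. u $ i / (1 + r * u $ i) * (real (y $ i) * tilt (r *\<^sub>R u) y)"
    have "F' r = ?E (\<lambda>n. ?D (trunc K n))"
      unfolding F'_def M_def
      by (subst Bochner_Integration.integral_sum)
         (auto intro!: integrable_trunc[where g = "\<lambda>y. real (y $ _) * tilt (r *\<^sub>R u) y"] simp del: trunc_nth)
    also have "\<dots> = (\<Sum>y\<in>range (trunc K). pmf (map_pmf (trunc K) \<mu>) y * ?D y)"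
      by (rule expectation_trunc)
    finally show ?thesis
      unfolding F_def expectation_trunc
      by (simp only:) (intro DERIV_sum DERIV_cmult tilt_has_derivative pos)
  qed
  have "ln (F 1) \<le> F' 0 / F 0"
  proof (rule le_deriv_at_0_if_euler_le[where \<phi>' = "\<lambda>r. F' r / F r"])
    show "((\<lambda>r. ln (F r)) has_real_derivative F' r / F r) (at r)" if "0 \<le> r" "r \<le> 1" for r
      using derivF[OF that] Fpos[OF that] by (auto intro!: derivative_eq_intros)
    show "ln (F 0) = 0"
      by (simp add: F_def tilt_def)
    show "r * (F' r / F r) \<le> ln (F r)" if "0 < r" "r \<le> 1" for r
    proof -
      \<comment> \<open>The factor r turns the coefficients of the ray derivative into those of
        \<open>WLSI1_tilt\<close> at \<open>r *\<^sub>R u\<close>.\<close>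
      have "r * F' r = (\<Sum>i\<in>UNIV. (r *\<^sub>R u) $ i / (1 + (r *\<^sub>R u) $ i) * M r i)"
        by (simp add: F'_def sum_distrib_left mult_ac)
      also have "\<dots> \<le> F r * ln (F r)"
        unfolding M_def F_def
        using that ru by (intro WLSI1_tilt mean wlsi) simp
      finally show ?thesis
        using Fpos[of r] that by (simp add: field_simps)
    qed
  qed
  \<comment> \<open>At r = 0 the tilt is constantly 1, so \<open>F 0\<close> is 1 and only the
    truncated means remain.\<close>
  also have "F' 0 / F 0 = (\<Sum>i\<in>UNIV. u $ i * ?E (\<lambda>n. real (trunc K n $ i)))"
    by (simp add: F'_def M_def F_def tilt_def)
  finally have "exp (ln (F 1)) \<le> exp (\<Sum>i\<in>UNIV. u $ i * ?E (\<lambda>n. real (trunc K n $ i)))"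
    by (simp only: exp_le_cancel_iff)
  then show ?thesis
    using Fpos[of 1] by (simp add: F_def del: trunc_nth exp_le_cancel_iff)
qed

section \<open>Removal of the truncation and the tail bound\<close>

lemma expectation_trunc_tendsto:
  assumes "integrable (measure_pmf \<mu>) (\<lambda>n. real (n $ i))"
  shows "(\<lambda>K. measure_pmf.expectation \<mu> (\<lambda>n. real (trunc K n $ i)))
    \<longlonglongrightarrow> measure_pmf.expectation \<mu> (\<lambda>n. real (n $ i))"
proof (rule integral_dominated_convergence[where w = "\<lambda>n. real (n $ i)"])
  show "AE n in measure_pmf \<mu>. (\<lambda>K. real (trunc K n $ i)) \<longlonglongrightarrow> real (n $ i)"
  proof (rule AE_I2)
    fix n
    show "(\<lambda>K. real (trunc K n $ i)) \<longlonglongrightarrow> real (n $ i)"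
      by (rule tendsto_eventually, rule eventually_sequentiallyI[of "n $ i"]) simp
  qed
qed (use assms in auto)

text \<open>Markov's inequality for the tilt. Multiplying by ln (1 + u_i) in the hypothesis covers
  lower and upper bounds on a coordinate at once: the sign of the logarithm decides which one is
  required.\<close>

lemma prob_le_expectation_tilt:
  fixes \<mu> :: "(nat ^ 'd::finite) pmf"
  assumes u: "\<And>i. u $ i > - 1"
    and S: "\<And>n i. n \<in> S \<Longrightarrow> a i * ln (1 + u $ i) \<le> real (trunc K n $ i) * ln (1 + u $ i)"
  shows "measure_pmf.prob \<mu> S * exp (\<Sum>i\<in>UNIV. a i * ln (1 + u $ i))
    \<le> measure_pmf.expectation \<mu> (\<lambda>n. tilt u (trunc K n))"
proof -
  let ?c = "exp (\<Sum>i\<in>UNIV. a i * ln (1 + u $ i))"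
  have "?c * indicator S n \<le> tilt u (trunc K n)" for n
  proof (cases "n \<in> S")
    case True
    then have "(\<Sum>i\<in>UNIV. a i * ln (1 + u $ i)) \<le> ln (tilt u (trunc K n))"
      unfolding ln_tilt[OF u] using S by (intro sum_mono)
    then show ?thesis
      using True tilt_pos[of u "trunc K n", OF u] by (simp add: ln_ge_iff)
  next
    case False
    then show ?thesis
      using tilt_pos[of u "trunc K n", OF u] by simp
  qed
  then have "measure_pmf.expectation \<mu> (\<lambda>n. ?c * indicator S n)
      \<le> measure_pmf.expectation \<mu> (\<lambda>n. tilt u (trunc K n))"
    by (intro integral_mono integrable_trunc integrable_mult_right integrable_real_indicator)
       (auto simp: less_top[symmetric])
  then show ?thesis
    by (simp add: mult.commute)
qed

theorem theorem5p2:
  fixes \<mu> :: "(nat ^ 'd::finite) pmf" and m t :: "real ^ 'd"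
  assumes "downward_closed (set_pmf \<mu>)"
    and "\<And>i. integrable (measure_pmf \<mu>) (\<lambda>n. real (n $ i))"
    and "\<And>i. m $ i = measure_pmf.expectation \<mu> (\<lambda>n. real (n $ i))"
    and "\<And>i. m $ i > 0"
    and "WLSI1 \<mu>"
    and "\<And>i. t $ i > - m $ i"
  shows "measure_pmf.prob \<mu> (orthant_event m t)
    \<le> exp (- (\<Sum>i\<in>UNIV. (t $ i)\<^sup>2 / (2 * m $ i) * h (t $ i / m $ i)))"
proof -
  let ?P = "measure_pmf.prob \<mu> (orthant_event m t)"
  \<comment> \<open>The optimal tilt: u m_i - (m_i + t_i) ln (1 + u) is minimal where 1 + u = (m_i +
    t_i) / m_i.\<close>
  define u :: "real ^ 'd" where "u = (\<chi> i. t $ i / m $ i)"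
  define M where "M = (\<lambda>K i. measure_pmf.expectation \<mu> (\<lambda>n. real (trunc K n $ i)))"
  define a where "a = (\<lambda>i. m $ i + t $ i)"
  let ?A = "\<Sum>i\<in>UNIV. a i * ln (1 + u $ i)"
  have u: "u $ i > - 1" for i
    using assms(4,6)[of i] by (simp add: u_def field_simps)
  \<comment> \<open>For K above every threshold \<open>a i\<close>, a coordinate that reaches its
    threshold still does so after truncation. Upper bounds on coordinates survive any
    truncation.\<close>
  have "eventually (\<lambda>K. \<forall>i\<in>UNIV. a i \<le> real K) sequentially"
    by (intro eventually_ball_finite ballI finite)
       (use filterlim_real_sequentially in \<open>auto simp: filterlim_at_top\<close>)
  then have "eventually (\<lambda>K. ?P \<le> exp ((\<Sum>i\<in>UNIV. u $ i * M K i) - ?A)) sequentially"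
  proof (rule eventually_mono)
    fix K assume K: "\<forall>i\<in>UNIV. a i \<le> real K"
    have "a i * ln (1 + u $ i) \<le> real (trunc K n $ i) * ln (1 + u $ i)"
      if n: "n \<in> orthant_event m t" for n i
    proof -
      consider "t $ i > 0" | "t $ i = 0" | "t $ i < 0"
        by linarith
      then show ?thesis
      proof cases
        case 1
        then have "u $ i > 0" "a i \<le> real (n $ i)"
          using n assms(4)[of i] by (auto simp: u_def a_def orthant_event_def)
        then show ?thesis
          using K by (intro mult_right_mono) (auto simp: min_def)
      next
        case 2
        then show ?thesis
          by (simp add: u_def)
      next
        case 3
        then have "u $ i < 0" "real (n $ i) \<le> a i"
          using n assms(4)[of i] by (auto simp: u_def a_def orthant_event_def divide_neg_pos)
        then show ?thesis
          using u[of i] by (intro mult_right_mono_neg) (auto simp: min_def)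
      qed
    qed
    from prob_le_expectation_tilt[OF u this]
    have "?P * exp ?A \<le> measure_pmf.expectation \<mu> (\<lambda>n. tilt u (trunc K n))"
      by blast
    also have "\<dots> \<le> exp (\<Sum>i\<in>UNIV. u $ i * M K i)"
      unfolding M_def by (intro expectation_tilt_le assms u)
    finally show "?P \<le> exp ((\<Sum>i\<in>UNIV. u $ i * M K i) - ?A)"
      by (simp add: exp_diff pos_le_divide_eq)
  qed
  moreover have "(\<lambda>K. exp ((\<Sum>i\<in>UNIV. u $ i * M K i) - ?A))
      \<longlonglongrightarrow> exp ((\<Sum>i\<in>UNIV. u $ i * m $ i) - ?A)"
    unfolding M_def assms(3)
    by (intro tendsto_exp tendsto_diff tendsto_sum tendsto_mult tendsto_const
        expectation_trunc_tendsto assms(2))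
  ultimately have "?P \<le> exp ((\<Sum>i\<in>UNIV. u $ i * m $ i) - ?A)"
    by (intro tendsto_lowerbound[where F = sequentially]) auto
  also have "(\<Sum>i\<in>UNIV. u $ i * m $ i) - ?A
      = - (\<Sum>i\<in>UNIV. (t $ i)\<^sup>2 / (2 * m $ i) * h (t $ i / m $ i))"
  proof -
    \<comment> \<open>With a_i = m_i (1 + u_i) the left side is -m_i ((1 + u_i) ln (1 + u_i) - u_i),
      and t_i^2 / m_i = m_i u_i^2 produces \<open>h\<close>. For t_i = 0 both sides vanish.\<close>
    have "u $ i * m $ i - a i * ln (1 + u $ i) = - ((t $ i)\<^sup>2 / (2 * m $ i) * h (t $ i / m $ i))" for i
    proof (cases "t $ i = 0")
      case False
      moreover define L where "L = ln (1 + t $ i / m $ i)"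
      moreover have "m $ i \<noteq> 0"
        using assms(4)[of i] by simp
      ultimately show ?thesis
        by (simp add: h_def u_def a_def L_def[symmetric] power2_eq_square field_simps)
    qed (simp add: u_def)
    then show ?thesis
      by (simp add: sum_subtractf[symmetric] sum_negf[symmetric])
  qed
  finally show ?thesis .
qed

end
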